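(* Let $x^*\in\mathbb{R}^n$ be a first-order stationary point of the problem $\min_{x\in\mathbb{R}^n}\{F(x)=f(x)+\lambda\|x\|_p^p\}$ satisfying $F(x^* )\le F(x^0)+\epsilon$ for some $x^0\in\mathbb{R}^n$ and $\epsilon\ge 0$. Let $\underline{f}=\inf_{x\in\mathbb{R}^n}f(x)$ and $\mathcal{B}=\{i:x^*_i\neq 0\}$. Then $$|x^*_i|\ \ge\ \left(\frac{\lambda p}{\sqrt{2L_f[F(x^0)+\epsilon-\underline{f}]}}\right)^{\frac{1}{1-p}},\qquad\forall i\in\mathcal{B}.$$
   Context: Here $\lambda>0$, $p\in(0,1)$, and $f:\mathbb{R}^n\to\mathbb{R}$ is a continuously differentiable function, bounded below on $\mathbb{R}^n$, whose gradient is $L_f$-Lipschitz continuous with $L_f>0$: $\|\nabla f(x)-\nabla f(y)\|_2\le L_f\|x-y\|_2$ for all $x,y\in\mathbb{R}^n$. Also $\|x\|_p^p=\sum_{i=1}^n|x_i|^p$. A vector $x^*$ is a first-order stationary point of the problem if $X^*\nabla f(x^* )+\lambda p|x^*|^p=0$, where $X^*=\mathrm{Diag}(x^* )$ and $|x^*|^p$ is the vector with components $|x^*_i|^p$; that is, $x^*_i\,\partial f(x^* )/\partial x_i+\lambda p|x^*_i|^p=0$ for all $i$. *)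

theory Defs
  imports "HOL-Analysis.Analysis"
begin

definition Diag :: "real ^ 'n \<Rightarrow> real ^ 'n ^ 'n" where
  "Diag v = (\<chi> i j. if i = j then v $ i else 0)"

(* The quantity ||x||_p^p itself; no p-th root is taken.  For p > 0 the convention
   0 powr p = 0 agrees with the usual value of 0^p. *)
definition lp_norm_pow :: "real \<Rightarrow> real ^ 'n \<Rightarrow> real" where
  "lp_norm_pow p x = (\<Sum>i\<in>UNIV. \<bar>x $ i\<bar> powr p)"

definition abs_powr_vec :: "real ^ 'n \<Rightarrow> real \<Rightarrow> real ^ 'n" where
  "abs_powr_vec x p = (\<chi> i. \<bar>x $ i\<bar> powr p)"

definition lp_objective :: "(real ^ 'n \<Rightarrow> real) \<Rightarrow> real \<Rightarrow> real \<Rightarrow> real ^ 'n \<Rightarrow> real" where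
  "lp_objective f lam p x = f x + lam * lp_norm_pow p x"

(* The vector g is the (unique) gradient of f at x. *)
definition lp_first_order_stationary ::
    "(real ^ 'n \<Rightarrow> real) \<Rightarrow> real \<Rightarrow> real \<Rightarrow> real ^ 'n \<Rightarrow> bool" where
  "lp_first_order_stationary f lam p x \<longleftrightarrow>
     (\<exists>g. GDERIV f x :> g \<and> Diag x *v g + (lam * p) *\<^sub>R abs_powr_vec x p = 0)"

end

theory Submission
  imports Defs
begin

text \<open>
  A gradient step of length \<open>1 / Lf\<close> from \<open>xstar\<close> decreases \<open>f\<close> by at least
  \<open>(norm g)\<^sup>2 / (2 * Lf)\<close>, where \<open>g\<close> is the gradient there. As \<open>f\<close> cannot fall below its
  infimum and \<open>f xstar \<le> F xstar\<close>, this bounds \<open>norm g\<close> by the square root in the claim.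
  Stationarity gives \<open>\<bar>g $ i\<bar> = lam * p * \<bar>xstar $ i\<bar> powr (p - 1)\<close> for \<open>i\<close> in the support of
  \<open>xstar\<close>; since \<open>p - 1 < 0\<close>, an upper bound on \<open>\<bar>g $ i\<bar>\<close> is a lower bound on \<open>\<bar>xstar $ i\<bar>\<close>.
\<close>

text \<open>Needed because \<open>lp_first_order_stationary\<close> only asserts that some gradient
  satisfies the equation; uniqueness identifies that witness with any given gradient.\<close>

lemma GDERIV_unique:
  fixes f :: "'a::real_inner \<Rightarrow> real"
  assumes "GDERIV f x :> g" and "GDERIV f x :> h"
  shows "g = h"
proof -
  have "(\<lambda>d. d \<bullet> g) = (\<lambda>d. d \<bullet> h)"
    using assms unfolding gderiv_def by (rule has_derivative_unique)
  then show ?thesis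
    by (metis inner_commute vector_eq_ldot)
qed

text \<open>Descent lemma: along the ray \<open>x + t *\<^sub>R v\<close>, Cauchy-Schwarz and the
  Lipschitz bound let the slope of \<open>f\<close> exceed its initial value by at most
  \<open>L * t * (norm v)\<^sup>2\<close>, which integrates to the quadratic term.\<close>

lemma Lipschitz_gradient_upper_bound:
  fixes f :: "'a::real_inner \<Rightarrow> real"
  assumes grad: "\<And>x. GDERIV f x :> gradf x"
    and lip: "\<And>x y. norm (gradf x - gradf y) \<le> L * norm (x - y)"
  shows "f (x + v) \<le> f x + gradf x \<bullet> v + L / 2 * (norm v)\<^sup>2"
proof -
  \<comment> \<open>The gap between \<open>f\<close> on the ray and its quadratic model. Comparing
    the monotone \<open>h\<close> at 0 and 1 replaces an integration.\<close>
  define h where "h = (\<lambda>t. f (x + t *\<^sub>R v) - t * (gradf x \<bullet> v) - L / 2 * t\<^sup>2 * (norm v)\<^sup>2)"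
  have deriv: "(h has_real_derivative (gradf (x + t *\<^sub>R v) - gradf x) \<bullet> v - L * t * (norm v)\<^sup>2) (at t)"
    for t
  proof -
    have "((\<lambda>t. x + t *\<^sub>R v) has_derivative (\<lambda>s. s *\<^sub>R v)) (at t)"
      by (auto intro!: derivative_eq_intros)
    from has_derivative_compose[OF this grad[unfolded gderiv_def]]
    have "((\<lambda>t. f (x + t *\<^sub>R v)) has_real_derivative gradf (x + t *\<^sub>R v) \<bullet> v) (at t)"
      by (simp add: has_field_derivative_def inner_commute mult.commute[of "v \<bullet> _"] mult_commute_abs)
    then show ?thesis
      unfolding h_def
      by (auto intro!: derivative_eq_intros simp: inner_diff_left)
  qed
  have "(gradf (x + t *\<^sub>R v) - gradf x) \<bullet> v \<le> L * t * (norm v)\<^sup>2" if "0 \<le> t" for t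
  proof -
    have "(gradf (x + t *\<^sub>R v) - gradf x) \<bullet> v \<le> norm (gradf (x + t *\<^sub>R v) - gradf x) * norm v"
      by (rule norm_cauchy_schwarz)
    also have "\<dots> \<le> (L * norm (x + t *\<^sub>R v - x)) * norm v"
      by (intro mult_right_mono lip) simp
    finally show ?thesis
      using that by (simp add: power2_eq_square mult.assoc)
  qed
  then have "h 1 \<le> h 0"
    by (intro DERIV_nonpos_imp_nonincreasing[of 0 1 h]) (use deriv in \<open>force+\<close>)
  then show ?thesis
    by (simp add: h_def)
qed

lemma Lipschitz_gradient_norm_bound:
  fixes f :: "'a::real_inner \<Rightarrow> real"
  assumes grad: "\<And>x. GDERIV f x :> gradf x"
    and lip: "\<And>x y. norm (gradf x - gradf y) \<le> L * norm (x - y)"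
    and "L > 0" and bdd: "bdd_below (range f)"
  shows "(norm (gradf x))\<^sup>2 \<le> 2 * L * (f x - (INF x. f x))"
proof -
  \<comment> \<open>The step \<open>- (1 / L) *\<^sub>R gradf x\<close> is the minimiser in
    \<open>v\<close> of the quadratic upper bound, so it gives the largest guaranteed
    decrease.\<close>
  have "(INF x. f x) \<le> f (x + - (1 / L) *\<^sub>R gradf x)"
    using bdd by (rule cINF_lower) simp
  also have "\<dots> \<le> f x + gradf x \<bullet> (- (1 / L) *\<^sub>R gradf x) + L / 2 * (norm (- (1 / L) *\<^sub>R gradf x))\<^sup>2"
    by (rule Lipschitz_gradient_upper_bound[OF grad lip])
  also have "\<dots> = f x - (norm (gradf x))\<^sup>2 / (2 * L)"
    using \<open>L > 0\<close> by (simp add: dot_square_norm power_mult_distrib power_divide field_simps power2_eq_square)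
  finally show ?thesis
    using \<open>L > 0\<close> by (simp add: field_simps)
qed

lemma stationary_gradient_component:
  assumes "lp_first_order_stationary f lam p x" and grad: "GDERIV f x :> g"
    and "x $ i \<noteq> 0" and "lam * p \<ge> 0"
  shows "\<bar>g $ i\<bar> = lam * p * \<bar>x $ i\<bar> powr (p - 1)"
proof -
  have "Diag x *v g + (lam * p) *\<^sub>R abs_powr_vec x p = 0"
    using assms GDERIV_unique unfolding lp_first_order_stationary_def by blast
  then have "(Diag x *v g + (lam * p) *\<^sub>R abs_powr_vec x p) $ i = 0"
    by simp
  moreover have "(Diag x *v g) $ i = x $ i * g $ i"
    by (simp add: Diag_def matrix_vector_mult_def if_distrib[of "\<lambda>c. c * _"] cong: if_cong)
  ultimately have "x $ i * g $ i = - (lam * p * \<bar>x $ i\<bar> powr p)"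
    by (simp add: abs_powr_vec_def)
  \<comment> \<open>Taking absolute values removes the minus sign, since \<open>lam * p\<close> is
    nonnegative; dividing by the nonzero \<open>\<bar>x $ i\<bar>\<close> then lowers the exponent
    to \<open>p - 1\<close>.\<close>
  then have "\<bar>x $ i * g $ i\<bar> = lam * p * \<bar>x $ i\<bar> powr p"
    using \<open>lam * p \<ge> 0\<close> by simp
  then show ?thesis
    using \<open>x $ i \<noteq> 0\<close> by (simp add: powr_diff abs_mult field_simps)
qed

theorem theorem2p3:
  fixes f :: "real ^ 'n \<Rightarrow> real"
    and gradf :: "real ^ 'n \<Rightarrow> real ^ 'n"
    and lam p Lf eps :: real
    and xstar x0 :: "real ^ 'n"
  assumes "lam > 0"
    and "0 < p" and "p < 1"
    and "\<And>x. GDERIV f x :> gradf x"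
    and "continuous_on UNIV gradf"
    and "bdd_below (range f)"
    and "Lf > 0"
    and "\<And>x y. norm (gradf x - gradf y) \<le> Lf * norm (x - y)"
    and "lp_first_order_stationary f lam p xstar"
    and "eps \<ge> 0"
    and "lp_objective f lam p xstar \<le> lp_objective f lam p x0 + eps"
  shows "\<forall>i\<in>{i. xstar $ i \<noteq> 0}.
    \<bar>xstar $ i\<bar> \<ge>
      (lam * p / sqrt (2 * Lf * (lp_objective f lam p x0 + eps - (INF x. f x)))) powr (1 / (1 - p))"
proof
  fix i assume "i \<in> {i. xstar $ i \<noteq> 0}"
  then have nz: "xstar $ i \<noteq> 0" by simp
  define S where "S = sqrt (2 * Lf * (lp_objective f lam p x0 + eps - (INF x. f x)))"
  have "lp_norm_pow p xstar \<ge> 0"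
    by (simp add: lp_norm_pow_def sum_nonneg)
  then have "f xstar \<le> lp_objective f lam p x0 + eps"
    using assms(1,11) unfolding lp_objective_def[of _ _ _ xstar]
    by (smt (verit) mult_nonneg_nonneg)
  then have "2 * Lf * (f xstar - (INF x. f x)) \<le> 2 * Lf * (lp_objective f lam p x0 + eps - (INF x. f x))"
    using assms(7) by simp
  with Lipschitz_gradient_norm_bound[OF assms(4,8,7,6), of xstar] have "norm (gradf xstar) \<le> S"
    unfolding S_def by (intro real_le_rsqrt) linarith
  then have "\<bar>gradf xstar $ i\<bar> \<le> S"
    using component_le_norm_cart order_trans by blast
  then have le: "lam * p * \<bar>xstar $ i\<bar> powr (p - 1) \<le> S"
    using stationary_gradient_component[OF assms(9,4) nz] assms(1,2) by simp
  \<comment> \<open>A nonzero entry of \<open>xstar\<close> forces a nonzero gradient component,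
    hence \<open>S > 0\<close>. The quotient by \<open>S\<close> is therefore genuine and not the
    default value of division by zero.\<close>
  have "0 < lam * p * \<bar>xstar $ i\<bar> powr (p - 1)"
    using assms(1,2) nz by simp
  with le have "S > 0" by linarith
  \<comment> \<open>Multiplying by the power \<open>1 - p\<close> cancels the negative exponent and
    turns the upper bound by \<open>S\<close> into a lower bound on
    \<open>\<bar>xstar $ i\<bar>\<close>.\<close>
  have "\<bar>xstar $ i\<bar> powr (p - 1) * \<bar>xstar $ i\<bar> powr (1 - p) = 1"
    using nz by (simp flip: powr_add)
  then have "lam * p = lam * p * \<bar>xstar $ i\<bar> powr (p - 1) * \<bar>xstar $ i\<bar> powr (1 - p)"
    by (simp add: mult.assoc)
  also have "\<dots> \<le> S * \<bar>xstar $ i\<bar> powr (1 - p)"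
    using le by (rule mult_right_mono) simp
  finally have "lam * p / S \<le> \<bar>xstar $ i\<bar> powr (1 - p)"
    using \<open>S > 0\<close> by (simp add: field_simps)
  then have "(lam * p / S) powr (1 / (1 - p)) \<le> (\<bar>xstar $ i\<bar> powr (1 - p)) powr (1 / (1 - p))"
    using assms(1-3) \<open>S > 0\<close> by (intro powr_mono2) auto
  also have "\<dots> = \<bar>xstar $ i\<bar>"
    using assms(3) by (simp add: powr_powr)
  finally show "\<bar>xstar $ i\<bar> \<ge>
      (lam * p / sqrt (2 * Lf * (lp_objective f lam p x0 + eps - (INF x. f x)))) powr (1 / (1 - p))"
    unfolding S_def .
qed

end
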